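(* Consider the nonexcludable binary public project problem with $n\ge 1$ agents whose valuations are drawn i.i.d. from a continuous distribution on $[0,1]$ with differentiable density $f$. If $f$ is log-concave, then the conservative equal costs mechanism (build the project if and only if $v_i\ge \frac1n$ for all $i$, in which case every agent pays $\frac1n$) maximizes the expected number of consumers among all strategy-proof and individually rational mechanisms. If $f$ is log-concave and welfare-concave, then the conservative equal costs mechanism maximizes the expected agents' welfare among all strategy-proof and individually rational mechanisms.
   Context: Model. There are $n$ agents. The project costs $1$ and is either built or not built. Agent $i$ has a private valuation $v_i\in[0,1]$; the $v_i$ are i.i.d. with density $f$ and CDF $F$. A (deterministic, measurable) mechanism maps each reported profile $(v_1,\dots,v_n)\in[0,1]^n$ to a decision (build / not build) and payments $p_i\ge 0$, such that $p_i=0$ for all $i$ if the project is not built and $\sum_i p_i=1$ if it is built. The project is nonexcludable: if it is built, all $n$ agents are consumers, and if it is not built, no agent is. Agent $i$'s utility is $v_i-p_i$ if the project is built and $0$ otherwise. Strategy-proof: for every $i$, every profile of the other agents' reports and every true $v_i$, agent $i$'s utility is maximized by reporting $v_i$. Individually rational: an agent who reports truthfully always has nonnegative utility. Expected number of consumers: the expectation of the number of consumers (that is, $n$ times the probability of building) under truthful reporting. Expected agents' welfare: the expectation of the sum of the agents' utilities under truthful reporting. Log-concave: $\log f(x)$ is concave in $x$ (with $\log 0=-\infty$). Welfare-concave: the function $$w(c)=\frac{\int_c^1 (x-c)f(x)\,dx}{\int_c^1 f(x)\,dx}$$ (the expected utility of an agent facing cost share $c$, conditional on $v_i\ge c$)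 is concave in $c$ on the set of $c\in[0,1]$ where $\int_c^1 f(x)\,dx>0$. *)

theory Defs
  imports "HOL-Probability.Probability"
begin

text \<open>Agents are the indices \<open>i < n\<close>. A profile of valuations is an element of the space of
  \<open>profile_space n\<close>, that is, a function in \<open>{..<n} \<rightarrow>\<^sub>E {0..1}\<close>; values outside this set
  and payments of indices \<open>i \<ge> n\<close> are never used.\<close>

record mechanism =
  built :: "(nat \<Rightarrow> real) \<Rightarrow> bool"
  payment :: "(nat \<Rightarrow> real) \<Rightarrow> nat \<Rightarrow> real"

definition profile_space :: "nat \<Rightarrow> (nat \<Rightarrow> real) measure" where
  "profile_space n = (\<Pi>\<^sub>M i\<in>{..<n}. restrict_space borel {0..1})"

definition profiles :: "nat \<Rightarrow> (nat \<Rightarrow> real) set" where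
  "profiles n = space (profile_space n)"

lemma profiles_eq: "profiles n = {..<n} \<rightarrow>\<^sub>E {0..1}"
  by (simp add: profiles_def profile_space_def space_PiM space_restrict_space)

definition public_project_mechanism :: "nat \<Rightarrow> mechanism \<Rightarrow> bool" where
  "public_project_mechanism n m \<longleftrightarrow>
     Measurable.pred (profile_space n) (built m) \<and>
     (\<forall>i<n. (\<lambda>v. payment m v i) \<in> borel_measurable (profile_space n)) \<and>
     (\<forall>v\<in>profiles n.
        (\<forall>i<n. 0 \<le> payment m v i) \<and>
        (\<not> built m v \<longrightarrow> (\<forall>i<n. payment m v i = 0)) \<and>
        (built m v \<longrightarrow> (\<Sum>i<n. payment m v i) = 1))"

text \<open>The utility of agent \<open>i\<close> with true valuation \<open>x\<close> under the reported profile \<open>v\<close>.\<close>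

definition utility :: "mechanism \<Rightarrow> nat \<Rightarrow> real \<Rightarrow> (nat \<Rightarrow> real) \<Rightarrow> real" where
  "utility m i x v = (if built m v then x - payment m v i else 0)"

definition strategy_proof :: "nat \<Rightarrow> mechanism \<Rightarrow> bool" where
  "strategy_proof n m \<longleftrightarrow>
     (\<forall>i<n. \<forall>v\<in>profiles n. \<forall>r\<in>{0..1}. utility m i (v i) (v(i := r)) \<le> utility m i (v i) v)"

definition individually_rational :: "nat \<Rightarrow> mechanism \<Rightarrow> bool" where
  "individually_rational n m \<longleftrightarrow> (\<forall>i<n. \<forall>v\<in>profiles n. 0 \<le> utility m i (v i) v)"

definition sp_ir_mechanism :: "nat \<Rightarrow> mechanism \<Rightarrow> bool" where
  "sp_ir_mechanism n m \<longleftrightarrow>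
     public_project_mechanism n m \<and> strategy_proof n m \<and> individually_rational n m"

definition conservative_equal_costs :: "nat \<Rightarrow> mechanism" where
  "conservative_equal_costs n =
     \<lparr>built = (\<lambda>v. \<forall>i<n. 1 / real n \<le> v i),
      payment = (\<lambda>v i. if \<forall>j<n. 1 / real n \<le> v j then 1 / real n else 0)\<rparr>"

text \<open>Only the values of a density on the unit interval are relevant.\<close>

definition is_density :: "(real \<Rightarrow> real) \<Rightarrow> bool" where
  "is_density f \<longleftrightarrow> (\<forall>x\<in>{0..1}. 0 \<le> f x) \<and> (f has_integral 1) {0..1}"

definition valuation_dist :: "(real \<Rightarrow> real) \<Rightarrow> real measure" where
  "valuation_dist f = density (restrict_space lborel {0..1}) (\<lambda>x. ennreal (f x))"

definition profile_dist :: "nat \<Rightarrow> (real \<Rightarrow> real) \<Rightarrow> (nat \<Rightarrow> real) measure" where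
  "profile_dist n f = (\<Pi>\<^sub>M i\<in>{..<n}. valuation_dist f)"

definition consumers :: "nat \<Rightarrow> mechanism \<Rightarrow> (nat \<Rightarrow> real) \<Rightarrow> nat set" where
  "consumers n m v = (if built m v then {..<n} else {})"

definition expected_consumers :: "nat \<Rightarrow> (real \<Rightarrow> real) \<Rightarrow> mechanism \<Rightarrow> real" where
  "expected_consumers n f m = (LINT v|profile_dist n f. real (card (consumers n m v)))"

definition expected_welfare :: "nat \<Rightarrow> (real \<Rightarrow> real) \<Rightarrow> mechanism \<Rightarrow> real" where
  "expected_welfare n f m = (LINT v|profile_dist n f. (\<Sum>i<n. utility m i (v i) v))"

definition log_ext :: "real \<Rightarrow> ereal" where
  "log_ext y = (if y = 0 then -\<infinity> else ereal (ln y))"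

text \<open>Concavity of the extended-real-valued function \<open>log f\<close> on the unit interval; at
  \<open>t \<in> {0, 1}\<close> the convention \<open>0 * (-\<infinity>) = 0\<close> makes the condition trivial.\<close>

definition log_concave :: "(real \<Rightarrow> real) \<Rightarrow> bool" where
  "log_concave f \<longleftrightarrow>
     (\<forall>x\<in>{0..1}. \<forall>y\<in>{0..1}. \<forall>t\<in>{0..1}.
        ereal (1 - t) * log_ext (f x) + ereal t * log_ext (f y)
          \<le> log_ext (f ((1 - t) * x + t * y)))"

definition conditional_utility :: "(real \<Rightarrow> real) \<Rightarrow> real \<Rightarrow> real" where
  "conditional_utility f c =
     integral {c..1} (\<lambda>x. (x - c) * f x) / integral {c..1} f"

definition welfare_concave :: "(real \<Rightarrow> real) \<Rightarrow> bool" where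
  "welfare_concave f \<longleftrightarrow>
     concave_on {c\<in>{0..1}. 0 < integral {c..1} f} (conditional_utility f)"

end

theory Submission
  imports Defs
begin

text \<open>Raising one report keeps the project built and raises no other agent's payment; since the
  payments always sum to 1, none of them changes. Comparing two profiles with their join, the
  payments are the same vector \<open>c\<close> at all profiles where the project is built, so it is built only
  if \<open>v i \<ge> c i\<close> for all \<open>i\<close>. Both objectives are thus bounded by their values for fixed cost shares
  \<open>c\<close>, which factor over the independent valuations. Log-concavity of \<open>f\<close> passes to the survival
  function, so by Jensen's inequality equal shares maximize the probability of building; if \<open>f\<close> is
  welfare-concave, they also maximize the sum of the conditional utilities.\<close>

section \<open>Strategy-proof mechanisms have fixed cost shares\<close>

lemma profiles_upd:
  assumes "v \<in> profiles n" "i < n" "r \<in> {0..1}"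
  shows "v(i := r) \<in> profiles n"
  using assms by (auto simp: profiles_eq PiE_iff extensional_def)

lemma profiles_bounds:
  assumes "v \<in> profiles n" "i < n"
  shows "0 \<le> v i" "v i \<le> 1"
  using assms by (auto simp: profiles_eq PiE_iff)

context
  fixes n :: nat and m :: mechanism
  assumes mech: "sp_ir_mechanism n m"
begin

lemma sp_ir_payment_nonneg:
  assumes "v \<in> profiles n" "i < n"
  shows "0 \<le> payment m v i"
  using mech assms by (auto simp: sp_ir_mechanism_def public_project_mechanism_def)

lemma sp_ir_payment_sum:
  assumes "v \<in> profiles n" "built m v"
  shows "(\<Sum>i<n. payment m v i) = 1"
  using mech assms by (auto simp: sp_ir_mechanism_def public_project_mechanism_def)

lemma sp_ir_payment_le:
  assumes "v \<in> profiles n" "built m v" "i < n"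
  shows "payment m v i \<le> v i"
  using mech assms
  by (force simp: sp_ir_mechanism_def individually_rational_def utility_def)

lemma sp_ir_deviation:
  assumes "v \<in> profiles n" "i < n" "r \<in> {0..1}"
  shows "utility m i (v i) (v(i := r)) \<le> utility m i (v i) v"
  using mech assms by (auto simp: sp_ir_mechanism_def strategy_proof_def)

text \<open>Take \<open>r\<close> as the true valuation: reporting \<open>v i\<close> would earn
  \<open>r - payment m v i > 0\<close>, whereas a profile that is not built yields 0.\<close>

lemma sp_ir_built_upd:
  assumes "v \<in> profiles n" "built m v" "i < n" "r \<in> {0..1}" "payment m v i < r"
  shows "built m (v(i := r))"
proof -
  have "utility m i r v \<le> utility m i r (v(i := r))"
    using sp_ir_deviation[of "v(i := r)" i "v i"] profiles_upd[of v n i r]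
      profiles_bounds[of v n i] assms by simp
  then show ?thesis
    using assms by (auto simp: utility_def split: if_splits)
qed

text \<open>Each of the two reports is a possible deviation when the other is the truth. With the
  project built at both, these two deviations bound each price by the other.\<close>

lemma sp_ir_payment_upd_own:
  assumes "v \<in> profiles n" "built m v" "i < n" "r \<in> {0..1}" "built m (v(i := r))"
  shows "payment m (v(i := r)) i = payment m v i"
proof -
  have "utility m i r v \<le> utility m i r (v(i := r))"
    using sp_ir_deviation[of "v(i := r)" i "v i"] profiles_upd[of v n i r]
      profiles_bounds[of v n i] assms by simp
  moreover have "utility m i (v i) (v(i := r)) \<le> utility m i (v i) v"
    using assms by (intro sp_ir_deviation)
  ultimately show ?thesis
    using assms by (auto simp: utility_def)
qed

lemma sp_ir_built_raise:
  assumes "v \<in> profiles n" "built m v" "i < n" "r \<in> {0..1}" "v i \<le> r"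
  shows "built m (v(i := r))"
proof (cases "r = v i")
  case False
  then show ?thesis
    using assms sp_ir_payment_le[of v i] by (intro sp_ir_built_upd) auto
qed (use assms in simp)

lemma sp_ir_payment_raise:
  assumes v: "v \<in> profiles n" "built m v" and i: "i < n" and r: "r \<in> {0..1}" "v i \<le> r"
    and k: "k < n"
  shows "payment m (v(i := r)) k = payment m v k"
proof -
  let ?w = "v(i := r)"
  have w: "?w \<in> profiles n" "built m ?w"
    using profiles_upd sp_ir_built_raise assms by auto
  \<comment> \<open>Otherwise a report \<open>x\<close> of agent \<open>j\<close> strictly between the two prices is still built at
    \<open>v(j := x)\<close>, hence also after raising report \<open>i\<close>, where agent \<open>j\<close> would pay more than \<open>x\<close>.\<close>
  have le: "payment m ?w j \<le> payment m v j" if j: "j < n" for j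
  proof (rule ccontr)
    assume "\<not> payment m ?w j \<le> payment m v j"
    then obtain x where x: "payment m v j < x" "x < payment m ?w j"
      using dense by (metis not_le)
    \<comment> \<open>Agent \<open>i\<close>'s own price does not depend on its report, so a price
      that rises belongs to another agent.\<close>
    have ji: "j \<noteq> i"
      using sp_ir_payment_upd_own[OF v i r(1)] w x by auto
    have x01: "x \<in> {0..1}"
      using x sp_ir_payment_nonneg[OF v(1) j] sp_ir_payment_le[OF w j]
        profiles_bounds[OF w(1) j] by auto
    have u: "v(j := x) \<in> profiles n" "built m (v(j := x))"
      using profiles_upd[OF v(1) j x01] sp_ir_built_upd[OF v j x01 x(1)] by auto
    have "built m (v(j := x, i := r))"
      using sp_ir_built_raise[OF u i r(1)] ji r by simp
    then have b: "built m (?w(j := x))"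
      using ji by (simp add: fun_upd_twist)
    have "payment m (?w(j := x)) j = payment m ?w j"
      by (rule sp_ir_payment_upd_own[OF w j x01 b])
    moreover have "payment m (?w(j := x)) j \<le> x"
      using sp_ir_payment_le[OF profiles_upd[OF w(1) j x01] b j] by simp
    ultimately show False
      using x by simp
  qed
  show ?thesis
  proof (rule ccontr)
    assume "payment m ?w k \<noteq> payment m v k"
    then have "payment m ?w k < payment m v k"
      using le[OF k] by simp
    then have "(\<Sum>j<n. payment m ?w j) < (\<Sum>j<n. payment m v j)"
      using le k by (intro sum_strict_mono_ex1) auto
    then show False
      using sp_ir_payment_sum v w by simp
  qed
qed

lemma sp_ir_payment_mono:
  assumes v: "v \<in> profiles n" "built m v" and w: "w \<in> profiles n"
    and le: "\<And>i. i < n \<Longrightarrow> v i \<le> w i"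
  shows "built m w \<and> (\<forall>j<n. payment m w j = payment m v j)"
proof -
  \<comment> \<open>A path from \<open>v\<close> to \<open>w\<close> that raises one report at a
    time; outside the indices below \<open>n\<close>, all profiles agree by extensionality.\<close>
  define u where "u = (\<lambda>k i. if i < k then w i else v i)"
  have step: "u (Suc k) = (u k)(k := w k)" for k
    by (auto simp: u_def fun_eq_iff less_Suc_eq)
  have "u k \<in> profiles n \<and> built m (u k) \<and> (\<forall>j<n. payment m (u k) j = payment m v j)"
    if "k \<le> n" for k
    using that
  proof (induction k)
    case 0
    then show ?case
      using v by (simp add: u_def)
  next
    case (Suc k)
    have "u k k \<le> w k" "w k \<in> {0..1}"
      using Suc.prems le profiles_bounds[OF w, of k] by (auto simp: u_def)
    moreover have "k < n"
      using Suc.prems by simp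
    moreover have "u k \<in> profiles n" "built m (u k)"
      "\<forall>j<n. payment m (u k) j = payment m v j"
      using Suc by auto
    ultimately have "(u k)(k := w k) \<in> profiles n" "built m ((u k)(k := w k))"
      "\<forall>j<n. payment m ((u k)(k := w k)) j = payment m v j"
      using profiles_upd sp_ir_built_raise sp_ir_payment_raise by simp_all
    then show ?case
      by (simp only: step simp_thms)
  qed
  moreover have "u n = w"
    using v(1) w by (auto simp: u_def profiles_eq fun_eq_iff PiE_iff extensional_def)
  ultimately show ?thesis
    by blast
qed

lemma sp_ir_payment_unique:
  assumes v: "v \<in> profiles n" "built m v" and w: "w \<in> profiles n" "built m w" and "j < n"
  shows "payment m v j = payment m w j"
proof -
  define z where "z = (\<lambda>i. max (v i) (w i))"
  have z: "z \<in> profiles n"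
    using v(1) w(1) by (auto simp: z_def profiles_eq PiE_iff extensional_def le_max_iff_disj)
  show ?thesis
    using sp_ir_payment_mono[OF v z] sp_ir_payment_mono[OF w z] assms(5) by (auto simp: z_def)
qed

lemma sp_ir_cost_shares:
  assumes "1 \<le> n"
  obtains c where "\<And>i. i < n \<Longrightarrow> 0 \<le> c i" "(\<Sum>i<n. c i) = 1"
    "\<And>v i. v \<in> profiles n \<Longrightarrow> built m v \<Longrightarrow> i < n \<Longrightarrow> payment m v i = c i \<and> c i \<le> v i"
proof (cases "\<exists>v\<in>profiles n. built m v")
  case True
  then obtain v where v: "v \<in> profiles n" "built m v"
    by blast
  show ?thesis
  proof (rule that[of "payment m v"])
    fix w i assume w: "w \<in> profiles n" "built m w" "i < n"
    then show "payment m w i = payment m v i \<and> payment m v i \<le> w i"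
      using sp_ir_payment_unique[OF v w] sp_ir_payment_le[OF w] by simp
  qed (simp_all add: v sp_ir_payment_nonneg sp_ir_payment_sum)
next
  \<comment> \<open>With no built profile the last claim is vacuous, so any nonnegative vector with
    sum 1 serves.\<close>
  case False
  then show ?thesis
    using assms by (intro that[of "\<lambda>_. 1 / real n"]) auto
qed

end

section \<open>Feasibility of the conservative equal costs mechanism\<close>

lemma measurable_component_profile_space [measurable]:
  assumes "i < n"
  shows "(\<lambda>v. v i) \<in> borel_measurable (profile_space n)"
proof -
  have "(\<lambda>v. v i) \<in> measurable (profile_space n) (restrict_space borel {0..1::real})"
    unfolding profile_space_def using assms by (intro measurable_component_singleton) auto
  then show ?thesis
    by (simp add: measurable_restrict_space2_iff)
qed

lemma built_conservative_equal_costs: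
  "built (conservative_equal_costs n) v \<longleftrightarrow> (\<forall>i<n. 1 / real n \<le> v i)"
  by (simp add: conservative_equal_costs_def)

lemma payment_conservative_equal_costs:
  "payment (conservative_equal_costs n) v i
    = (if built (conservative_equal_costs n) v then 1 / real n else 0)"
  by (simp add: conservative_equal_costs_def)

lemma sp_ir_conservative_equal_costs:
  assumes "1 \<le> n"
  shows "sp_ir_mechanism n (conservative_equal_costs n)"
proof -
  let ?m = "conservative_equal_costs n"
  have "Measurable.pred (profile_space n) (\<lambda>v. \<forall>i\<in>{..<n}. 1 / real n \<le> v i)"
    by measurable
  then have [measurable]: "Measurable.pred (profile_space n) (built ?m)"
    by (simp add: built_conservative_equal_costs[abs_def])
  have "public_project_mechanism n ?m"
    unfolding public_project_mechanism_def payment_conservative_equal_costs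
    using assms by simp
  moreover have "strategy_proof n ?m"
    unfolding strategy_proof_def
  proof (intro allI impI ballI)
    fix i v r assume i: "i < n"
    have *: "utility ?m j x u = (if built ?m u then x - 1 / real n else 0)" for j x u
      by (simp add: utility_def payment_conservative_equal_costs)
    have "1 / real n \<le> v i" if "built ?m v"
      using that i by (simp add: built_conservative_equal_costs)
    \<comment> \<open>Only report \<open>i\<close> changes, so a deviation that gets the project
      built when truth does not means that agent \<open>i\<close> values it below the price.\<close>
    moreover have "built ?m v \<or> v i < 1 / real n" if "built ?m (v(i := r))"
      using that unfolding not_le[symmetric] built_conservative_equal_costs by (metis fun_upd_other)
    ultimately show "utility ?m i (v i) (v(i := r)) \<le> utility ?m i (v i) v"
      unfolding * by auto
  qed
  moreover have "individually_rational n ?m"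
    by (simp add: individually_rational_def utility_def payment_conservative_equal_costs
        built_conservative_equal_costs)
  ultimately show ?thesis
    by (simp add: sp_ir_mechanism_def)
qed

section \<open>Survival functions of log-concave densities\<close>

text \<open>The points \<open>x + s\<close> and \<open>y\<close> lie between \<open>x\<close> and
  \<open>y + s\<close> and have the same sum, so they are convex combinations of these endpoints
  with swapped weights. Adding the two concavity inequalities for \<open>ln f\<close> gives the
  claim.\<close>

lemma log_concave_exchange:
  assumes lc: "log_concave f" and nonneg: "\<And>x. x \<in> {0..1} \<Longrightarrow> 0 \<le> f x"
    and "0 \<le> x" "x \<le> y" "0 \<le> s" "y + s \<le> 1"
  shows "f x * f (y + s) \<le> f (x + s) * f y"
proof -
  define z where "z = y + s"
  have mem: "x \<in> {0..1}" "z \<in> {0..1}" "x + s \<in> {0..1}" "y \<in> {0..1}"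
    using assms by (auto simp: z_def)
  consider "f x = 0 \<or> f z = 0" | "x = y \<or> s = 0" | "f x \<noteq> 0" "f z \<noteq> 0" "x < y" "0 < s"
    using assms by linarith
  then show ?thesis
  proof cases
    case 1
    then have "f x * f (y + s) = 0"
      by (auto simp: z_def)
    moreover have "0 \<le> f (x + s) * f y"
      using nonneg mem by (intro mult_nonneg_nonneg)
    ultimately show ?thesis
      by linarith
  next
    case 2
    then show ?thesis by (auto simp: mult.commute)
  next
    case 3
    have pos: "0 < f x" "0 < f z"
      using 3 nonneg mem by (auto simp: less_le)
    \<comment> \<open>The left side of the extended inequality is finite, which excludes the value
      \<open>-\<infinity>\<close> on the right and so forces \<open>f u > 0\<close>.\<close>
    have ln_le: "0 < f u \<and> (1 - t) * ln (f x) + t * ln (f z) \<le> ln (f u)"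
      if t: "t \<in> {0..1}" and u: "u = (1 - t) * x + t * z" for t u
    proof -
      have "u \<in> {0..1}"
        unfolding u using convexD_alt[of "{0..1::real}" x z t] mem t by simp
      moreover have "ereal (1 - t) * log_ext (f x) + ereal t * log_ext (f z) \<le> log_ext (f u)"
        using lc mem(1,2) t unfolding u log_concave_def by blast
      then have "ereal ((1 - t) * ln (f x) + t * ln (f z)) \<le> log_ext (f u)"
        using pos by (simp add: log_ext_def)
      ultimately show ?thesis
        using nonneg[of u] by (auto simp: log_ext_def less_le split: if_splits)
    qed
    \<comment> \<open>Solves \<open>(1 - t) * x + t * z = x + s\<close>; the weight
      \<open>1 - t\<close> then yields \<open>y\<close>.\<close>
    define t where "t = s / (z - x)"
    have zx: "z - x > 0"
      using 3 by (simp add: z_def)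
    have t: "t \<in> {0..1}" "1 - t \<in> {0..1}"
      using 3 zx by (auto simp: t_def z_def divide_simps)
    have tz: "t * (z - x) = s"
      using zx by (simp add: t_def)
    have A: "0 < f (x + s)" "(1 - t) * ln (f x) + t * ln (f z) \<le> ln (f (x + s))"
      using ln_le[OF t(1), of "x + s"] tz by (auto simp: algebra_simps)
    have B: "0 < f y" "t * ln (f x) + (1 - t) * ln (f z) \<le> ln (f y)"
      using ln_le[OF t(2), of y] tz by (auto simp: algebra_simps z_def)
    have "ln (f x * f z) = ln (f x) + ln (f z)"
      using pos by (simp add: ln_mult)
    also have "\<dots> \<le> ln (f (x + s)) + ln (f y)"
      using A(2) B(2) by (simp add: algebra_simps)
    also have "\<dots> = ln (f (x + s) * f y)"
      using A B by (simp add: ln_mult)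
    finally have "f x * f z \<le> f (x + s) * f y"
      using pos A B by simp
    then show ?thesis by (simp add: z_def)
  qed
qed

locale valuation_density =
  fixes f :: "real \<Rightarrow> real"
  assumes nonneg: "\<And>x. x \<in> {0..1} \<Longrightarrow> 0 \<le> f x"
    and cont: "continuous_on {0..1} f"
    and total: "integral {0..1} f = 1"
begin

definition survival :: "real \<Rightarrow> real" where
  "survival c = integral {c..1} f"

lemma cont_tail: "0 \<le> c \<Longrightarrow> continuous_on {c..1} f"
  using cont by (rule continuous_on_subset) auto

lemma survival_nonneg: "0 \<le> c \<Longrightarrow> 0 \<le> survival c"
  unfolding survival_def using nonneg
  by (intro integral_nonneg integrable_continuous_interval cont_tail) auto

text \<open>Clears the denominator even where \<open>survival c = 0\<close>: since
  \<open>x - c \<le> 1\<close>, the numerator lies between 0 and \<open>survival c\<close>, so both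
  sides vanish there.\<close>

lemma conditional_utility_eq:
  assumes "c \<in> {0..1}"
  shows "integral {c..1} (\<lambda>x. (x - c) * f x) = survival c * conditional_utility f c"
    and "0 \<le> conditional_utility f c"
proof -
  have int: "(\<lambda>x. (x - c) * f x) integrable_on {c..1}" "f integrable_on {c..1}"
    using assms by (auto intro!: integrable_continuous_interval continuous_intros cont_tail)
  have W: "0 \<le> integral {c..1} (\<lambda>x. (x - c) * f x)"
    using assms nonneg int by (intro integral_nonneg) auto
  have "(x - c) * f x \<le> f x" if "x \<in> {c..1}" for x
    using that assms nonneg[of x] by (intro mult_left_le_one_le) auto
  then have "integral {c..1} (\<lambda>x. (x - c) * f x) \<le> survival c"
    unfolding survival_def using int by (intro integral_le) auto
  then show "integral {c..1} (\<lambda>x. (x - c) * f x) = survival c * conditional_utility f c"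
    using W by (auto simp: conditional_utility_def survival_def)
  show "0 \<le> conditional_utility f c"
    using W survival_nonneg[of c] assms by (simp add: conditional_utility_def survival_def)
qed

text \<open>Monotonicity of the hazard rate \<open>f / survival\<close>, cross-multiplied to allow a
  zero survival value. The tail above \<open>y\<close> is a translate of \<open>{x..1 - d}\<close>;
  the exchange inequality with \<open>s = u - x\<close> is integrated over \<open>u\<close> there,
  and the interval is then enlarged to \<open>{x..1}\<close>.\<close>

lemma hazard_rate_mono:
  assumes lc: "log_concave f" and xy: "0 \<le> x" "x \<le> y" "y \<le> 1"
  shows "f x * survival y \<le> f y * survival x"
proof -
  define d where "d = y - x"
  have int: "f integrable_on {x..1 - d}" "f integrable_on {y..1}" "f integrable_on {x..1}"
    using xy by (auto simp: d_def intro!: integrable_continuous_interval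
        intro: continuous_on_subset[OF cont])
  have "((f \<circ> (+) d) has_integral survival y) {x..1 - d}"
    unfolding has_integral_shift_Icc_real using int by (simp add: d_def survival_def integrable_integral)
  then have shift: "((\<lambda>u. f x * f (u + d)) has_integral f x * survival y) {x..1 - d}"
    by (intro has_integral_mult_right) (simp add: o_def add.commute)
  have "f x * survival y \<le> f y * integral {x..1 - d} f"
  proof (rule has_integral_le[OF shift])
    show "((\<lambda>u. f y * f u) has_integral f y * integral {x..1 - d} f) {x..1 - d}"
      using int by (intro has_integral_mult_right) auto
    show "f x * f (u + d) \<le> f y * f u" if "u \<in> {x..1 - d}" for u
      using log_concave_exchange[OF lc nonneg, of x y "u - x"] that xy
      by (auto simp: d_def algebra_simps)
  qed
  also have "integral {x..1 - d} f \<le> survival x"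
    unfolding survival_def using int nonneg xy
    by (intro integral_subset_le) (auto simp: d_def)
  finally show ?thesis
    using nonneg[of y] xy by (auto simp: mult_left_mono)
qed

lemma survival_derivative:
  assumes "0 < x" "x < 1"
  shows "(survival has_real_derivative - f x) (at x)"
proof -
  have "(survival has_real_derivative - f x) (at x within {0..1})"
    unfolding survival_def[abs_def]
    using assms by (intro integral_has_real_derivative' cont) auto
  then show ?thesis
    using assms at_within_Icc_at[of 0 x 1] by simp
qed

lemma survival_continuous: "continuous_on {0..1} survival"
  unfolding survival_def[abs_def]
  by (intro indefinite_integral_continuous_1' integrable_continuous_interval cont)

text \<open>The tangent inequality at \<open>a\<close> for the concave function \<open>ln survival\<close>, exponentiated so that
  zeros of the survival function need no separate treatment.\<close>

lemma survival_le_exp: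
  assumes lc: "log_concave f" and a: "a \<in> {0..1}" "0 < survival a" and c: "c \<in> {0..1}"
  shows "survival c \<le> survival a * exp (- (f a / survival a) * (c - a))"
proof -
  \<comment> \<open>The hazard rate at \<open>a\<close>, which is minus the slope of
    \<open>ln survival\<close> there. Up to a constant factor, \<open>\<phi>\<close> is the ratio of
    \<open>survival\<close> to its exponential tangent at \<open>a\<close>.\<close>
  define h where "h = f a / survival a"
  define \<phi> where "\<phi> = (\<lambda>c. survival c * exp (h * (c - a)))"
  have deriv: "(\<phi> has_real_derivative (h * survival x - f x) * exp (h * (x - a))) (at x)"
    if "0 < x" "x < 1" for x
    unfolding \<phi>_def
    by (rule derivative_eq_intros survival_derivative that refl)+ (simp add: algebra_simps)
  have cont_\<phi>: "continuous_on {x..y} \<phi>" if "0 \<le> x" "y \<le> 1" for x y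
    unfolding \<phi>_def using that
    by (intro continuous_intros continuous_on_subset[OF survival_continuous]) auto
  \<comment> \<open>The hazard rate is at most \<open>h\<close> to the left of \<open>a\<close> and
    at least \<open>h\<close> to the right, so \<open>\<phi>\<close> rises up to \<open>a\<close>
    and falls afterwards (both weakly).\<close>
  have "\<phi> c \<le> \<phi> a"
  proof (cases "c \<le> a")
    case True
    show ?thesis
    proof (rule DERIV_nonneg_imp_increasing_open[OF True _ cont_\<phi>])
      fix x assume x: "c < x" "x < a"
      have "f x \<le> h * survival x"
        using hazard_rate_mono[OF lc, of x a] x a c by (simp add: h_def field_simps)
      then show "\<exists>y. (\<phi> has_real_derivative y) (at x) \<and> 0 \<le> y"
        using deriv[of x] x a c
        by (intro exI[of _ "(h * survival x - f x) * exp (h * (x - a))"]) auto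
    qed (use a c in auto)
  next
    case False
    then have "a \<le> c" by simp
    then show ?thesis
    proof (rule DERIV_nonpos_imp_decreasing_open[OF _ _ cont_\<phi>])
      fix x assume x: "a < x" "x < c"
      have "h * survival x \<le> f x"
        using hazard_rate_mono[OF lc, of a x] x a c by (simp add: h_def field_simps)
      then show "\<exists>y. (\<phi> has_real_derivative y) (at x) \<and> y \<le> 0"
        using deriv[of x] x a c
        by (intro exI[of _ "(h * survival x - f x) * exp (h * (x - a))"])
          (auto intro!: mult_nonpos_nonneg)
    qed (use a c in auto)
  qed
  then have "survival c * exp (h * (c - a)) \<le> survival a"
    by (simp add: \<phi>_def)
  then have "survival c * exp (h * (c - a)) * exp (- h * (c - a))
      \<le> survival a * exp (- h * (c - a))"
    by (rule mult_right_mono) simp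
  then show ?thesis
    by (simp add: h_def[symmetric] mult.assoc exp_add[symmetric])
qed

text \<open>Jensen's inequality in multiplicative form: in the product of the tangent bounds at
  \<open>a = 1 / n\<close> the exponents cancel, because the shares average to
  \<open>a\<close>.\<close>

lemma prod_survival_le:
  assumes lc: "log_concave f" and n: "1 \<le> n"
    and c: "\<And>i. i < n \<Longrightarrow> c i \<in> {0..1}" and sum: "(\<Sum>i<n. c i) = 1"
  shows "(\<Prod>i<n. survival (c i)) \<le> survival (1 / real n) ^ n"
proof -
  define a where "a = 1 / real n"
  have a: "a \<in> {0..1}"
    using n by (simp add: a_def)
  have nonneg': "\<And>i. i < n \<Longrightarrow> 0 \<le> survival (c i)"
    using c survival_nonneg by auto
  consider "survival a = 0" | "0 < survival a"
    using survival_nonneg[of a] a by fastforce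
  then show ?thesis
  proof cases
    \<comment> \<open>There is no tangent bound at \<open>a\<close> here. Some share is at least the
      average \<open>a\<close>, and its survival factor vanishes by monotonicity.\<close>
    case 1
    obtain i where i: "i < n" "a \<le> c i"
    proof (rule ccontr)
      assume "\<not> thesis"
      then have "(\<Sum>i<n. c i) < (\<Sum>i<n. a)"
        using n that by (intro sum_strict_mono) (auto simp: not_le[symmetric] lessThan_empty_iff)
      then show False
        using n sum by (simp add: a_def)
    qed
    have "survival (c i) \<le> survival a"
      unfolding survival_def using i a c[of i] nonneg
      by (intro integral_subset_le integrable_continuous_interval cont_tail) auto
    then have "survival (c i) = 0"
      using 1 nonneg'[OF i(1)] by simp
    then have eq: "(\<Prod>i<n. survival (c i)) = 0"
      using i by auto
    show ?thesis
      unfolding eq using survival_nonneg[of a] a by (simp add: a_def)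
  next
    case 2
    let ?h = "f a / survival a"
    have "(\<Prod>i<n. survival (c i)) \<le> (\<Prod>i<n. survival a * exp (- ?h * (c i - a)))"
      using survival_le_exp[OF lc a 2] c nonneg' by (intro prod_mono) blast
    also have "\<dots> = survival a ^ n * exp (\<Sum>i<n. - ?h * (c i - a))"
      by (simp add: prod.distrib exp_sum)
    also have "(\<Sum>i<n. - ?h * (c i - a)) = - ?h * ((\<Sum>i<n. c i) - n * a)"
      unfolding sum_distrib_left[symmetric] by (simp add: sum_subtractf)
    also have "\<dots> = 0"
      using n sum by (simp add: a_def)
    finally show ?thesis
      by (simp add: a_def)
  qed
qed

section \<open>Expectations\<close>

lemma f_measurable: "f \<in> borel_measurable (restrict_space lborel {0..1})"
  using borel_measurable_continuous_on_restrict[OF cont]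
  by (simp cong: measurable_cong_sets add: sets_restrict_space)

text \<open>Bridge from Lebesgue integrals over \<open>valuation_dist f\<close> to the gauge
  integrals in the definitions. Taking \<open>g x = 1\<close> gives the survival function, and
  \<open>g x = x - c\<close> the numerator of the conditional utility.\<close>

lemma has_bochner_integral_valuation_dist:
  fixes g :: "real \<Rightarrow> real"
  assumes c: "c \<in> {0..1}" and g: "continuous_on {0..1} g"
  shows "has_bochner_integral (valuation_dist f) (\<lambda>x. indicator {c..} x * g x)
    (integral {c..1} (\<lambda>x. g x * f x))"
proof -
  let ?R = "restrict_space lborel {0..1::real}"
  have gm: "g \<in> borel_measurable ?R"
    using borel_measurable_continuous_on_restrict[OF g]
    by (simp cong: measurable_cong_sets add: sets_restrict_space)
  have "indicator {c..} \<in> borel_measurable lborel"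
    by simp
  then have im: "(indicator {c..} :: real \<Rightarrow> real) \<in> borel_measurable ?R"
    by (rule measurable_restrict_space1)
  have m: "(\<lambda>x. indicator {c..} x * g x) \<in> borel_measurable ?R"
    using gm im by (rule borel_measurable_times[rotated])
  have ae: "AE x in ?R. 0 \<le> f x"
    using nonneg by (intro AE_I2) (auto simp: space_restrict_space)
  have gf: "continuous_on {c..1} (\<lambda>x. g x * f x)"
    using c by (intro continuous_intros cont_tail continuous_on_subset[OF g]) auto
  have si: "set_integrable lborel {c..1} (\<lambda>x. g x * f x)"
    by (rule borel_integrable_atLeastAtMost'[OF gf])
  have eq: "indicator {0..1} x *\<^sub>R (f x *\<^sub>R (indicator {c..} x * g x))
      = indicator {c..1} x *\<^sub>R (g x * f x)" for x
    using c by (auto simp: indicator_def)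
  have "integrable (valuation_dist f) (\<lambda>x. indicator {c..} x * g x)"
    unfolding valuation_dist_def using si
    by (subst integrable_density[OF m f_measurable ae], subst integrable_restrict_space)
      (simp_all only: eq set_integrable_def, simp)
  moreover have "integral\<^sup>L (valuation_dist f) (\<lambda>x. indicator {c..} x * g x)
      = integral {c..1} (\<lambda>x. g x * f x)"
    unfolding valuation_dist_def set_borel_integral_eq_integral(2)[OF si, symmetric]
    by (subst integral_density[OF m f_measurable ae], subst integral_restrict_space)
      (simp_all only: eq set_lebesgue_integral_def, simp)
  ultimately show ?thesis
    by (simp add: has_bochner_integral_iff)
qed

lemma prob_space_valuation_dist: "prob_space (valuation_dist f)"
proof
  let ?R = "restrict_space lborel {0..1::real}"
  have si: "set_integrable lborel {0..1} f"
    by (rule borel_integrable_atLeastAtMost'[OF cont])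
  have i: "integrable ?R f"
    using si by (subst integrable_restrict_space) (auto simp: set_integrable_def)
  have "emeasure (valuation_dist f) (space (valuation_dist f)) = (\<integral>\<^sup>+x. ennreal (f x) \<partial>?R)"
    unfolding valuation_dist_def space_density
    using f_measurable
    by (subst emeasure_density[OF _ sets.top]) (auto intro!: nn_integral_cong)
  also have "\<dots> = ennreal (integral\<^sup>L ?R f)"
    using nonneg by (intro nn_integral_eq_integral i AE_I2) (auto simp: space_restrict_space)
  also have "integral\<^sup>L ?R f = 1"
    using set_borel_integral_eq_integral(2)[OF si] total
    by (subst integral_restrict_space) (auto simp: set_lebesgue_integral_def)
  finally show "emeasure (valuation_dist f) (space (valuation_dist f)) = 1"
    by simp
qed

lemma space_profile_dist: "space (profile_dist n f) = profiles n"
  by (simp add: profile_dist_def valuation_dist_def profiles_eq space_PiM space_restrict_space)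

text \<open>Independence of the valuations: a product of functions of single coordinates integrates
  factor by factor.\<close>

lemma has_bochner_integral_profile_dist:
  fixes g :: "nat \<Rightarrow> real \<Rightarrow> real"
  assumes "\<And>i. i < n \<Longrightarrow> c i \<in> {0..1}" "\<And>i. i < n \<Longrightarrow> continuous_on {0..1} (g i)"
  shows "has_bochner_integral (profile_dist n f) (\<lambda>v. \<Prod>i<n. indicator {c i..} (v i) * g i (v i))
    (\<Prod>i<n. integral {c i..1} (\<lambda>x. g i x * f x))"
proof -
  interpret P: product_sigma_finite "\<lambda>_::nat. valuation_dist f"
    using prob_space_valuation_dist
    by (intro product_sigma_finite.intro prob_space_imp_sigma_finite)
  have *: "integrable (valuation_dist f) (\<lambda>x. indicator {c i..} x * g i x)"
    "integral\<^sup>L (valuation_dist f) (\<lambda>x. indicator {c i..} x * g i x)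
      = integral {c i..1} (\<lambda>x. g i x * f x)" if "i < n" for i
    using has_bochner_integral_valuation_dist[of "c i" "g i"] assms that
    by (auto simp: has_bochner_integral_iff)
  show ?thesis
    unfolding has_bochner_integral_iff profile_dist_def
    using P.product_integrable_prod[of "{..<n}" "\<lambda>i x. indicator {c i..} x * g i x"]
      P.product_integral_prod[of "{..<n}" "\<lambda>i x. indicator {c i..} x * g i x"] *
    by simp
qed

lemma has_bochner_integral_accept:
  assumes "\<And>i. i < n \<Longrightarrow> c i \<in> {0..1}"
  shows "has_bochner_integral (profile_dist n f) (\<lambda>v. \<Prod>i<n. indicator {c i..} (v i))
    (\<Prod>i<n. survival (c i))"
  using has_bochner_integral_profile_dist[of n c "\<lambda>_ _. 1"] assms
  by (simp add: survival_def)

lemma has_bochner_integral_accept_welfare: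
  assumes c: "\<And>i. i < n \<Longrightarrow> c i \<in> {0..1}"
  shows "has_bochner_integral (profile_dist n f)
    (\<lambda>v. (\<Prod>i<n. indicator {c i..} (v i)) * (\<Sum>i<n. v i - c i))
    ((\<Prod>i<n. survival (c i)) * (\<Sum>i<n. conditional_utility f (c i)))"
proof -
  \<comment> \<open>Puts agent \<open>j\<close>'s surplus into coordinate \<open>j\<close> and 1
    into the others, so that each summand of the welfare is a product over coordinates.\<close>
  define g where "g = (\<lambda>j i x. if i = j then x - c i else 1)"
  have fg: "(\<Prod>i<n. indicator {c i..} (v i) * g j i (v i))
      = (\<Prod>i<n. indicator {c i..} (v i)) * (v j - c j)" if "j < n" for j v
    using that by (simp add: g_def prod.distrib)
  have int: "integral {c i..1} (\<lambda>x. g j i x * f x)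
      = survival (c i) * (if i = j then conditional_utility f (c i) else 1)" if "i < n" for i j
    using conditional_utility_eq(1)[OF c[OF that]]
    by (cases "i = j") (auto simp: g_def survival_def)
  have "has_bochner_integral (profile_dist n f)
      (\<lambda>v. (\<Prod>i<n. indicator {c i..} (v i)) * (v j - c j))
      ((\<Prod>i<n. survival (c i)) * conditional_utility f (c j))" if "j < n" for j
  proof -
    have "continuous_on {0..1} (g j i)" for i
      unfolding g_def by (cases "i = j") (auto intro!: continuous_intros)
    then have "has_bochner_integral (profile_dist n f)
        (\<lambda>v. \<Prod>i<n. indicator {c i..} (v i) * g j i (v i))
        (\<Prod>i<n. integral {c i..1} (\<lambda>x. g j i x * f x))"
      using c by (intro has_bochner_integral_profile_dist) auto
    moreover have "(\<Prod>i<n. integral {c i..1} (\<lambda>x. g j i x * f x))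
        = (\<Prod>i<n. survival (c i)) * conditional_utility f (c j)"
      using that by (simp add: int prod.distrib)
    ultimately show ?thesis
      by (simp only: fg[OF that])
  qed
  then show ?thesis
    unfolding sum_distrib_left by (intro has_bochner_integral_sum) auto
qed

lemma prod_indicator_eq:
  "(\<Prod>i<n. indicator {c i..} (v i)) = (if \<forall>i<n. c i \<le> v i then 1 else (0::real))"
  for c v :: "nat \<Rightarrow> real"
  by (auto simp: indicator_def)

section \<open>Values of the equal costs mechanism and bounds for arbitrary fixed cost
  shares\<close>

lemma expected_consumers_equal_costs:
  assumes "1 \<le> n"
  shows "expected_consumers n f (conservative_equal_costs n) = real n * survival (1 / real n) ^ n"
proof -
  have "real (card (consumers n (conservative_equal_costs n) v))
      = real n * (\<Prod>i<n. indicator {1 / real n..} (v i))" for v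
    unfolding prod_indicator_eq by (auto simp: consumers_def built_conservative_equal_costs)
  then show ?thesis
    using has_bochner_integral_accept[of n "\<lambda>_. 1 / real n"] assms
    by (simp add: expected_consumers_def has_bochner_integral_iff)
qed

lemma expected_welfare_equal_costs:
  assumes "1 \<le> n"
  shows "expected_welfare n f (conservative_equal_costs n)
    = survival (1 / real n) ^ n * (real n * conditional_utility f (1 / real n))"
proof -
  have "(\<Sum>i<n. utility (conservative_equal_costs n) i (v i) v)
      = (\<Prod>i<n. indicator {1 / real n..} (v i)) * (\<Sum>i<n. v i - 1 / real n)" for v
    unfolding prod_indicator_eq
    by (cases "built (conservative_equal_costs n) v")
      (simp_all add: utility_def payment_conservative_equal_costs
        flip: built_conservative_equal_costs)
  then show ?thesis
    using has_bochner_integral_accept_welfare[of n "\<lambda>_. 1 / real n"] assms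
    by (simp add: expected_welfare_def has_bochner_integral_iff)
qed

lemma expected_consumers_le:
  assumes c: "\<And>i. i < n \<Longrightarrow> c i \<in> {0..1}"
    and B: "\<And>v i. v \<in> profiles n \<Longrightarrow> built m v \<Longrightarrow> i < n \<Longrightarrow> c i \<le> v i"
  shows "expected_consumers n f m \<le> real n * (\<Prod>i<n. survival (c i))"
proof -
  have i: "has_bochner_integral (profile_dist n f)
      (\<lambda>v. real n * (\<Prod>i<n. indicator {c i..} (v i))) (real n * (\<Prod>i<n. survival (c i)))"
    using c by (intro has_bochner_integral_mult_right has_bochner_integral_accept)
  have "expected_consumers n f m
      \<le> (LINT v|profile_dist n f. real n * (\<Prod>i<n. indicator {c i..} (v i)))"
    unfolding expected_consumers_def
  \<comment> \<open>A mechanism may refuse to build although every agent accepts its share, so the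
    pointwise comparison is only an inequality. The rule asks for integrability and nonnegativity of
    the larger side.\<close>
  proof (rule integral_mono')
    fix v assume "v \<in> space (profile_dist n f)"
    then show "real (card (consumers n m v)) \<le> real n * (\<Prod>i<n. indicator {c i..} (v i))"
      using B[of v] unfolding prod_indicator_eq
      by (auto simp: consumers_def space_profile_dist)
  qed (use i in \<open>auto simp: has_bochner_integral_iff intro!: mult_nonneg_nonneg prod_nonneg\<close>)
  then show ?thesis
    using i by (simp only: has_bochner_integral_iff)
qed

lemma expected_welfare_le:
  assumes c: "\<And>i. i < n \<Longrightarrow> c i \<in> {0..1}"
    and B: "\<And>v i. v \<in> profiles n \<Longrightarrow> built m v \<Longrightarrow> i < n \<Longrightarrow> payment m v i = c i \<and> c i \<le> v i"
  shows "expected_welfare n f m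
    \<le> (\<Prod>i<n. survival (c i)) * (\<Sum>i<n. conditional_utility f (c i))"
proof -
  note i = has_bochner_integral_accept_welfare[of n c, OF c]
  \<comment> \<open>Covers the profiles that are not built, where all utilities are 0.\<close>
  have nonneg': "0 \<le> (\<Prod>i<n. indicator {c i..} (v i)) * (\<Sum>i<n. v i - c i)" for v
    unfolding prod_indicator_eq by (auto intro!: sum_nonneg)
  have "expected_welfare n f m
      \<le> (LINT v|profile_dist n f. (\<Prod>i<n. indicator {c i..} (v i)) * (\<Sum>i<n. v i - c i))"
    unfolding expected_welfare_def
  proof (rule integral_mono')
    fix v assume v: "v \<in> space (profile_dist n f)"
    show "(\<Sum>i<n. utility m i (v i) v)
        \<le> (\<Prod>i<n. indicator {c i..} (v i)) * (\<Sum>i<n. v i - c i)"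
    proof (cases "built m v")
      case True
      then show ?thesis
        using B[of v] v unfolding prod_indicator_eq
        by (auto simp: utility_def space_profile_dist intro!: sum_mono)
    next
      case False
      then show ?thesis
        using nonneg'[of v] by (simp add: utility_def)
    qed
  qed (use i nonneg' in \<open>auto simp: has_bochner_integral_iff\<close>)
  then show ?thesis
    using i by (simp only: has_bochner_integral_iff)
qed

text \<open>The building probability and the sum of conditional utilities are bounded separately;
  both are nonnegative, so the bounds multiply.\<close>

lemma accept_welfare_le:
  assumes lc: "log_concave f" and wc: "welfare_concave f" and n: "1 \<le> n"
    and c: "\<And>i. i < n \<Longrightarrow> c i \<in> {0..1}" and sum: "(\<Sum>i<n. c i) = 1"
  shows "(\<Prod>i<n. survival (c i)) * (\<Sum>i<n. conditional_utility f (c i))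
    \<le> survival (1 / real n) ^ n * (real n * conditional_utility f (1 / real n))"
proof (cases "\<exists>i<n. survival (c i) = 0")
  \<comment> \<open>Such a share lies outside the domain of welfare-concavity, but the product of
    survival values is then 0.\<close>
  case True
  then have eq: "(\<Prod>i<n. survival (c i)) = 0"
    by auto
  show ?thesis
    unfolding eq using n conditional_utility_eq(2)[of "1 / real n"] survival_nonneg[of "1 / real n"] by simp
next
  case False
  then have pos: "0 < survival (c i)" if "i < n" for i
    using survival_nonneg[of "c i"] c[OF that] that by (force simp: less_le)
  \<comment> \<open>Jensen's inequality with equal weights; the mean of the shares is
    \<open>1 / n\<close>.\<close>
  have "(\<Sum>i<n. 1 / real n * conditional_utility f (c i))
      \<le> conditional_utility f (\<Sum>i<n. (1 / real n) *\<^sub>R c i)"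
    using n pos c
    by (intro concave_on_sum[OF _ _ wc[unfolded welfare_concave_def]])
      (auto simp: survival_def lessThan_empty_iff)
  also have "(\<Sum>i<n. (1 / real n) *\<^sub>R c i) = 1 / real n"
    using sum by (simp add: sum_divide_distrib[symmetric])
  finally have "(\<Sum>i<n. conditional_utility f (c i)) \<le> real n * conditional_utility f (1 / real n)"
    using n by (simp add: sum_divide_distrib[symmetric] field_simps)
  then show ?thesis
    using prod_survival_le[OF lc n c sum] c n conditional_utility_eq(2) survival_nonneg
    by (intro mult_mono) (auto intro!: sum_nonneg)
qed

end

theorem theorem3p3:
  fixes n :: nat and f :: "real \<Rightarrow> real"
  assumes "1 \<le> n"
    and "is_density f"
    and "f differentiable_on {0..1}"
  shows "(log_concave f \<longrightarrow>
            is_arg_max (expected_consumers n f) (sp_ir_mechanism n) (conservative_equal_costs n)) \<and>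
         (log_concave f \<and> welfare_concave f \<longrightarrow>
            is_arg_max (expected_welfare n f) (sp_ir_mechanism n) (conservative_equal_costs n))"
proof -
  interpret valuation_density f
    using assms(2) differentiable_imp_continuous_on[OF assms(3)]
    by unfold_locales (auto simp: is_density_def)
  have bounds: "expected_consumers n f m \<le> expected_consumers n f (conservative_equal_costs n) \<and>
      (welfare_concave f \<longrightarrow>
        expected_welfare n f m \<le> expected_welfare n f (conservative_equal_costs n))"
    if lc: "log_concave f" and m: "sp_ir_mechanism n m" for m
  proof -
    \<comment> \<open>One vector of cost shares of \<open>m\<close> serves both objectives.\<close>
    obtain c where c: "\<And>i. i < n \<Longrightarrow> 0 \<le> c i" "(\<Sum>i<n. c i) = 1"
      "\<And>v i. v \<in> profiles n \<Longrightarrow> built m v \<Longrightarrow> i < n \<Longrightarrow> payment m v i = c i \<and> c i \<le> v i"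
      using sp_ir_cost_shares[OF m assms(1)] by metis
    have c01: "c i \<in> {0..1}" if "i < n" for i
      using member_le_sum[of i "{..<n}" c] c(1,2) that by auto
    have "expected_consumers n f m \<le> real n * (\<Prod>i<n. survival (c i))"
      using c(3) by (intro expected_consumers_le c01) auto
    also have "\<dots> \<le> real n * survival (1 / real n) ^ n"
      using prod_survival_le[OF lc assms(1) c01 c(2)] by (intro mult_left_mono) auto
    finally have "expected_consumers n f m
        \<le> expected_consumers n f (conservative_equal_costs n)"
      by (simp only: expected_consumers_equal_costs[OF assms(1)])
    moreover have "expected_welfare n f m
        \<le> expected_welfare n f (conservative_equal_costs n)" if "welfare_concave f"
      unfolding expected_welfare_equal_costs[OF assms(1)]
      using order_trans[OF expected_welfare_le[OF c01 c(3)]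
          accept_welfare_le[OF lc that assms(1) c01 c(2)]] by blast
    ultimately show ?thesis by blast
  qed
  show ?thesis
    using bounds sp_ir_conservative_equal_costs[OF assms(1)]
    by (auto simp: is_arg_max_def not_less)
qed

end
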